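(* Let $P$ and $Q$ be finite posets such that $P$ is both $d$-decomposable and $c$-decomposable and $Q$ is $d$-decomposable. Then the maximum size of a semiantichain in $P\times Q$ equals the minimum size of a unichain covering of $P\times Q$, and this common value is $$\sum_{i=1}^{\min(h(P),h(Q))}\mu_i^P\mu_i^Q=\sum_{j=1}^{w(P)} d_{\lambda_j^P}(Q).$$
   Context: All posets are finite. $h(P)$ and $w(P)$ denote the height (size of a largest chain) and width (size of a largest antichain) of $P$. The product $P\times Q$ is ordered by $(u,x)\le(v,y)$ iff $u\le_P v$ and $x\le_Q y$. A unichain in $P\times Q$ is a chain of the form $\{p\}\times C'$ ($C'$ a chain of $Q$) or $C\times\{q\}$ ($C$ a chain of $P$); a unichain covering is a family of unichains whose union is $P\times Q$. A semiantichain is a set $S\subseteq P\times Q$ such that no two distinct elements of $S$ lie in a common unichain. A $k$-antichain (resp. $k$-chain) is a union of $k$ antichains (resp. $k$ disjoint chains); $d_k(P)$ (resp. $c_k(P)$) is the maximum size of a $k$-antichain (resp. $k$-chain) of $P$, with $d_0=c_0=0$. Set $\mu_k^P=d_k(P)-d_{k-1}(P)$ and $\lambda_k^P=c_k(P)-c_{k-1}(P)$ (by Greene's theorem, $\lambda^P$ is a partition of $|P|$ with conjugate partition $\mu^P$). $P$ is $d$-decomposable if it has a partition into antichains $A_1,\dots,A_{h(P)}$ with $|A_1\cup\dots\cup A_k|=d_k(P)$ for every $k$; $P$ is $c$-decomposable if it has a partition into chains $C_1,\dots,C_{w(P)}$ with $|C_1\cup\dots\cup C_k|=c_k(P)$ for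 every $k$. *)

theory Defs
  imports Main "HOL-Library.Disjoint_Sets"
begin

text \<open>
  A poset is given by its reflexive order relation \<open>P\<close>, with ground set \<open>Field P\<close>.
  Chains are the members of \<^const>\<open>Chains\<close>; as \<open>Chains P\<close> only contains sets of
  elements related to themselves, these are subsets of \<open>Field P\<close>.
\<close>

definition finite_poset :: "'a rel \<Rightarrow> bool" where
  "finite_poset P \<longleftrightarrow> Partial_order P \<and> finite (Field P)"

definition antichains :: "'a rel \<Rightarrow> 'a set set" where
  "antichains P = {A. A \<subseteq> Field P \<and> (\<forall>x\<in>A. \<forall>y\<in>A. (x, y) \<in> P \<longrightarrow> x = y)}"

definition height :: "'a rel \<Rightarrow> nat" where
  "height P = Max (card ` Chains P)"

definition width :: "'a rel \<Rightarrow> nat" where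
  "width P = Max (card ` antichains P)"

text \<open>The \<open>k\<close> antichains (chains) may be empty, so that \<open>k\<close>-antichains and \<open>k\<close>-chains
  exist for all \<open>k\<close>.\<close>

definition k_antichains :: "'a rel \<Rightarrow> nat \<Rightarrow> 'a set set" where
  "k_antichains P k = {\<Union>i\<in>{1..k}. A i |A. \<forall>i\<in>{1..k}. A i \<in> antichains P}"

definition k_chains :: "'a rel \<Rightarrow> nat \<Rightarrow> 'a set set" where
  "k_chains P k = {\<Union>i\<in>{1..k}. C i |C.
     (\<forall>i\<in>{1..k}. C i \<in> Chains P) \<and> disjoint_family_on C {1..k}}"

definition max_k_antichain :: "'a rel \<Rightarrow> nat \<Rightarrow> nat" where
  "max_k_antichain P k = Max (card ` k_antichains P k)"

definition max_k_chain :: "'a rel \<Rightarrow> nat \<Rightarrow> nat" where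
  "max_k_chain P k = Max (card ` k_chains P k)"

text \<open>The Greene-Kleitman numbers \<open>\<mu>\<^sub>k\<close> and \<open>\<lambda>\<^sub>k\<close>, for \<open>k \<ge> 1\<close>. Subtraction on \<^typ>\<open>nat\<close>
  does not truncate here, since both sequences are nondecreasing in \<open>k\<close>.\<close>

definition greene_mu :: "'a rel \<Rightarrow> nat \<Rightarrow> nat" where
  "greene_mu P k = max_k_antichain P k - max_k_antichain P (k - 1)"

definition greene_lambda :: "'a rel \<Rightarrow> nat \<Rightarrow> nat" where
  "greene_lambda P k = max_k_chain P k - max_k_chain P (k - 1)"

definition d_decomposable :: "'a rel \<Rightarrow> bool" where
  "d_decomposable P \<longleftrightarrow> (\<exists>A.
     (\<forall>i\<in>{1..height P}. A i \<in> antichains P \<and> A i \<noteq> {}) \<and>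
     disjoint_family_on A {1..height P} \<and>
     (\<Union>i\<in>{1..height P}. A i) = Field P \<and>
     (\<forall>k\<in>{1..height P}. card (\<Union>i\<in>{1..k}. A i) = max_k_antichain P k))"

definition c_decomposable :: "'a rel \<Rightarrow> bool" where
  "c_decomposable P \<longleftrightarrow> (\<exists>C.
     (\<forall>i\<in>{1..width P}. C i \<in> Chains P \<and> C i \<noteq> {}) \<and>
     disjoint_family_on C {1..width P} \<and>
     (\<Union>i\<in>{1..width P}. C i) = Field P \<and>
     (\<forall>k\<in>{1..width P}. card (\<Union>i\<in>{1..k}. C i) = max_k_chain P k))"

definition prod_poset :: "'a rel \<Rightarrow> 'b rel \<Rightarrow> ('a \<times> 'b) rel" where
  "prod_poset P Q = {((u, x), (v, y)) |u x v y. (u, v) \<in> P \<and> (x, y) \<in> Q}"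

definition unichains :: "'a rel \<Rightarrow> 'b rel \<Rightarrow> ('a \<times> 'b) set set" where
  "unichains P Q = {U \<in> Chains (prod_poset P Q).
     (\<exists>p\<in>Field P. \<exists>C\<in>Chains Q. U = {p} \<times> C) \<or>
     (\<exists>q\<in>Field Q. \<exists>C\<in>Chains P. U = C \<times> {q})}"

definition unichain_coverings :: "'a rel \<Rightarrow> 'b rel \<Rightarrow> ('a \<times> 'b) set set set" where
  "unichain_coverings P Q = {\<U>. \<U> \<subseteq> unichains P Q \<and> \<Union>\<U> = Field P \<times> Field Q}"

definition semiantichains :: "'a rel \<Rightarrow> 'b rel \<Rightarrow> ('a \<times> 'b) set set" where
  "semiantichains P Q = {S. S \<subseteq> Field P \<times> Field Q \<and>
     (\<forall>s\<in>S. \<forall>t\<in>S. s \<noteq> t \<longrightarrow> \<not> (\<exists>U\<in>unichains P Q. s \<in> U \<and> t \<in> U))}"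

end

theory Submission
  imports Defs
begin

text \<open>
  If \<open>A\<^sub>i\<close> and \<open>B\<^sub>i\<close> are the antichains of the given decompositions of \<open>P\<close> and \<open>Q\<close>, the union of
  the \<open>A\<^sub>i \<times> B\<^sub>i\<close> is a semiantichain. Conversely, \<open>P \<times> Q\<close> is the union of the \<open>C\<^sub>j \<times> Q\<close>, where the \<open>C\<^sub>j\<close>
  form the chain decomposition of \<open>P\<close>, and each \<open>C\<^sub>j \<times> Q\<close> is covered by \<open>d\<^sub>k(Q)\<close> unichains for
  \<open>k = |C\<^sub>j|\<close>: by the Greene-Kleitman theorem there are \<open>m\<close> disjoint chains in \<open>Q\<close> leaving at most
  \<open>d\<^sub>k(Q) - k m\<close> elements uncovered; take \<open>k\<close> copies of each of them and one copy of \<open>C\<^sub>j\<close> for every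
  uncovered element. The same theorem applied to \<open>P\<close> shows that \<open>\<lambda>\<close> and \<open>\<mu>\<close> are conjugate,
  whence the two bounds agree.

  The Greene-Kleitman theorem is obtained from linear programming duality for the assignment
  problem on \<open>Field P\<close> with weights \<open>k\<close> for pairs \<open>x < y\<close>, \<open>k - 1\<close> for \<open>x = y\<close> and \<open>0\<close> otherwise.
  An optimal permutation is a family of chains with its fixed points uncovered. For an optimal
  integral dual solution \<open>(u, v)\<close>, the elements with \<open>u x + v x = k - 1\<close> form a \<open>k\<close>-antichain,
  since \<open>v\<close> increases strictly along chains of such elements and takes at most \<open>k\<close> values.
\<close>

section \<open>Hall's theorem and duality for the assignment problem\<close>

text \<open>Induction on the size of \<open>A\<close>. If some nonempty proper subset is tight, it
  and its complement are matched separately; otherwise every such subset has a spare neighbour, so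
  one pair can be fixed arbitrarily.\<close>

lemma hall_matching:
  assumes "finite A" and "\<And>x. x \<in> A \<Longrightarrow> finite (N x)"
    and "\<And>X. X \<subseteq> A \<Longrightarrow> card X \<le> card (\<Union>(N ` X))"
  shows "\<exists>f. inj_on f A \<and> (\<forall>x\<in>A. f x \<in> N x)"
  using assms
proof (induction "card A" arbitrary: A N rule: less_induct)
  case less
  note finA = less.prems(1) and finN = less.prems(2) and hall = less.prems(3)
  show ?case
  proof (cases "A = {}")
    case True
    then show ?thesis by simp
  next
    case False
    then obtain a where a: "a \<in> A" by blast
    show ?thesis
    proof (cases "\<exists>X. X \<noteq> {} \<and> X \<subset> A \<and> card (\<Union>(N ` X)) = card X")
      case True
      then obtain X where X: "X \<noteq> {}" "X \<subset> A" "card (\<Union>(N ` X)) = card X" by blast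
      have finX: "finite X" using X finA finite_subset by blast
      have finNX: "finite (\<Union>(N ` X))" using X finX finN by blast
      have "card X < card A" using X finA by (simp add: psubset_card_mono)
      then obtain f where f: "inj_on f X" "\<And>x. x \<in> X \<Longrightarrow> f x \<in> N x"
        using less.hyps[of X N] finX finN hall X(2) by (metis psubsetE subset_iff subset_trans)
      \<comment> \<open>The neighbours of \<open>X\<close> are reserved for \<open>X\<close>. Hall's
        condition for \<open>X \<union> Y\<close>, minus the equality for the tight set
        \<open>X\<close>, leaves Hall's condition for \<open>Y\<close> with respect to
        \<open>N'\<close>.\<close>
      define N' where "N' x = N x - \<Union>(N ` X)" for x
      have "card Y \<le> card (\<Union>(N' ` Y))" if Y: "Y \<subseteq> A - X" for Y
      proof -
        have finY: "finite Y" using Y finA finite_subset by blast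
        have finNY: "finite (\<Union>(N' ` Y))" using Y finY finN unfolding N'_def by blast
        have "card X + card Y = card (X \<union> Y)"
          using Y finX finY by (subst card_Un_disjoint) auto
        also have "\<dots> \<le> card (\<Union>(N ` (X \<union> Y)))" using hall[of "X \<union> Y"] X Y by blast
        also have "\<Union>(N ` (X \<union> Y)) = \<Union>(N ` X) \<union> \<Union>(N' ` Y)" unfolding N'_def by blast
        also have "card \<dots> \<le> card (\<Union>(N ` X)) + card (\<Union>(N' ` Y))" by (rule card_Un_le)
        finally show ?thesis using X(3) by simp
      qed
      moreover have "card (A - X) < card A"
        using X finA by (intro psubset_card_mono) auto
      ultimately obtain g where g: "inj_on g (A - X)" "\<And>x. x \<in> A - X \<Longrightarrow> g x \<in> N' x"
        using less.hyps[of "A - X" N'] finA finN unfolding N'_def by auto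
      define h where "h x = (if x \<in> X then f x else g x)" for x
      have "inj_on h A"
      proof (rule inj_onI)
        fix x y assume xy: "x \<in> A" "y \<in> A" "h x = h y"
        show "x = y"
        proof (cases "x \<in> X \<longleftrightarrow> y \<in> X")
          case True
          then show ?thesis using xy f(1) g(1) by (auto simp: h_def inj_on_def split: if_splits)
        next
          case False
          then show ?thesis using xy f(2) g(2) unfolding h_def N'_def
            by (metis DiffD2 DiffI UN_I)
        qed
      qed
      moreover have "\<forall>x\<in>A. h x \<in> N x" using f(2) g(2) unfolding h_def N'_def by auto
      ultimately show ?thesis by blast
    next
      case False
      have "card {a} \<le> card (N a)" using hall[of "{a}"] a by simp
      then obtain b where b: "b \<in> N a" by fastforce
      \<comment> \<open>With \<open>a\<close> matched to \<open>b\<close>, every other set of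
        vertices loses at most the neighbour \<open>b\<close>, which the strict inequality for
        nonempty proper subsets absorbs.\<close>
      define N' where "N' x = N x - {b}" for x
      have "card Y \<le> card (\<Union>(N' ` Y))" if Y: "Y \<subseteq> A - {a}" for Y
      proof (cases "Y = {}")
        case True
        then show ?thesis by simp
      next
        case ne: False
        have "Y \<subset> A" using Y a by blast
        then have "card Y < card (\<Union>(N ` Y))"
          using hall[of Y] False ne by (metis le_neq_implies_less psubset_imp_subset)
        moreover have "\<Union>(N' ` Y) = \<Union>(N ` Y) - {b}" unfolding N'_def by blast
        ultimately show ?thesis using diff_card_le_card_Diff[of "{b}" "\<Union>(N ` Y)"] by simp
      qed
      moreover have "card (A - {a}) < card A" using a finA by (rule card_Diff1_less[rotated])
      ultimately obtain g where g: "inj_on g (A - {a})" "\<And>x. x \<in> A - {a} \<Longrightarrow> g x \<in> N' x"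
        using less.hyps[of "A - {a}" N'] finA finN unfolding N'_def by auto
      define h where "h x = (if x = a then b else g x)" for x
      have "inj_on h A"
      proof (rule inj_onI)
        fix x y assume xy: "x \<in> A" "y \<in> A" "h x = h y"
        then show "x = y" using g unfolding h_def N'_def inj_on_def
          by (auto split: if_splits)
      qed
      moreover have "\<forall>x\<in>A. h x \<in> N x" using b g(2) unfolding h_def N'_def by auto
      ultimately show ?thesis by blast
    qed
  qed
qed

lemma sum_of_bool_mem:
  assumes "finite V" "Y \<subseteq> V"
  shows "(\<Sum>x\<in>V. of_bool (x \<in> Y)) = int (card Y)"
  using assms by (simp add: sum.inter_restrict[symmetric] Int_absorb1 flip: Int_def)

text \<open>Take an integral feasible pair \<open>(u, v)\<close> of least total. If its tight pairs
  violated Hall's condition, shifting by one would give a smaller feasible pair, so they contain a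
  permutation. The sign condition on the diagonal bounds totals below by 0, so a minimum
  exists.\<close>

lemma assignment_duality:
  fixes w :: "'a \<Rightarrow> 'a \<Rightarrow> int"
  assumes fin: "finite V" and diag: "\<And>x. x \<in> V \<Longrightarrow> 0 \<le> w x x"
  obtains u v :: "'a \<Rightarrow> int" and s :: "'a \<Rightarrow> 'a"
  where "\<And>x y. x \<in> V \<Longrightarrow> y \<in> V \<Longrightarrow> w x y \<le> u x + v y"
    and "bij_betw s V V"
    and "\<And>x. x \<in> V \<Longrightarrow> w x (s x) = u x + v (s x)"
proof -
  define feas where "feas p \<longleftrightarrow> (\<forall>x\<in>V. \<forall>y\<in>V. w x y \<le> fst p x + snd p y)"
    for p :: "('a \<Rightarrow> int) \<times> ('a \<Rightarrow> int)"
  define val where "val p = (\<Sum>x\<in>V. fst p x + snd p x)" for p :: "('a \<Rightarrow> int) \<times> ('a \<Rightarrow> int)"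
  have val_nonneg: "0 \<le> val p" if "feas p" for p
    unfolding val_def using that diag by (intro sum_nonneg) (force simp: feas_def)
  \<comment> \<open>The pair \<open>(B, 0)\<close> shows that feasible pairs exist; inserting 0
    keeps \<open>Max\<close> defined for empty \<open>V\<close>.\<close>
  define B where "B = Max (insert 0 ((\<lambda>(x, y). w x y) ` (V \<times> V)))"
  have "w x y \<le> B" if "x \<in> V" "y \<in> V" for x y
    unfolding B_def using that fin by (intro Max_ge) force+
  then have "feas (\<lambda>_. B, \<lambda>_. 0)" by (simp add: feas_def)
  from ex_has_least_nat[of feas, OF this, of "\<lambda>p. nat (val p)"]
  obtain p where p: "feas p" and least: "\<And>q. feas q \<Longrightarrow> nat (val p) \<le> nat (val q)" by blast
  obtain u v where uv: "p = (u, v)" by (cases p)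
  have feasible: "\<And>x y. x \<in> V \<Longrightarrow> y \<in> V \<Longrightarrow> w x y \<le> u x + v y"
    using p by (simp add: feas_def uv)
  define N where "N x = {y \<in> V. w x y = u x + v y}" for x
  have "card X \<le> card (\<Union>(N ` X))" if X: "X \<subseteq> V" for X
  proof (rule ccontr)
    assume neg: "\<not> card X \<le> card (\<Union>(N ` X))"
    let ?Y = "\<Union>(N ` X)"
    have Y: "?Y \<subseteq> V" by (auto simp: N_def)
    \<comment> \<open>Only pairs from \<open>X\<close> to the outside of \<open>?Y\<close> lose
      slack. They are not tight, so by integrality they have slack at least 1 to lose. The total
      changes by \<open>card ?Y - card X < 0\<close>.\<close>
    define q where "q = (\<lambda>x. u x - of_bool (x \<in> X), \<lambda>y. v y + of_bool (y \<in> ?Y))"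
    have "w x y \<le> fst q x + snd q y" if xy: "x \<in> V" "y \<in> V" for x y
    proof (cases "x \<in> X \<and> y \<notin> ?Y")
      case True
      then have "w x y \<noteq> u x + v y" using xy by (auto simp: N_def)
      then show ?thesis using feasible[OF xy] True by (simp add: q_def)
    next
      case False
      then show ?thesis using feasible[OF xy] by (auto simp: q_def)
    qed
    then have q: "feas q" by (simp add: feas_def)
    have "val q = val p - (\<Sum>x\<in>V. of_bool (x \<in> X)) + (\<Sum>x\<in>V. of_bool (x \<in> ?Y))"
      unfolding val_def q_def uv by (simp add: sum.distrib sum_subtractf)
    also have "(\<Sum>x\<in>V. of_bool (x \<in> X)) = int (card X)"
      by (rule sum_of_bool_mem[OF fin X])
    also have "(\<Sum>x\<in>V. of_bool (x \<in> ?Y)) = int (card ?Y)"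
      by (rule sum_of_bool_mem[OF fin Y])
    finally show False using least[OF q] val_nonneg[OF q] neg by linarith
  qed
  then obtain s where s: "inj_on s V" "\<And>x. x \<in> V \<Longrightarrow> s x \<in> N x"
    using hall_matching[of V N] fin by (auto simp: N_def)
  have "s ` V \<subseteq> V" using s(2) by (auto simp: N_def)
  then have "bij_betw s V V"
    using s(1) fin by (simp add: bij_betw_def endo_inj_surj)
  then show thesis using that[of u v s] feasible s(2) by (simp add: N_def)
qed

section \<open>The Greene-Kleitman theorem\<close>

lemma Chains_subset_Field: "C \<in> Chains P \<Longrightarrow> C \<subseteq> Field P"
  unfolding Chains_def Field_def by blast

lemma k_antichains_subset_Field: "S \<in> k_antichains P k \<Longrightarrow> S \<subseteq> Field P"
  unfolding k_antichains_def antichains_def by blast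

lemma k_chains_subset_Field: "S \<in> k_chains P k \<Longrightarrow> S \<subseteq> Field P"
  unfolding k_chains_def using Chains_subset_Field by blast

lemma finite_k_antichains: "finite (Field P) \<Longrightarrow> finite (k_antichains P k)"
  using k_antichains_subset_Field by (metis Pow_iff finite_Pow_iff finite_subset subsetI)

lemma finite_k_chains: "finite (Field P) \<Longrightarrow> finite (k_chains P k)"
  using k_chains_subset_Field by (metis Pow_iff finite_Pow_iff finite_subset subsetI)

lemma card_le_max_k_antichain:
  "finite (Field P) \<Longrightarrow> S \<in> k_antichains P k \<Longrightarrow> card S \<le> max_k_antichain P k"
  unfolding max_k_antichain_def by (simp add: finite_k_antichains)

lemma card_le_max_k_chain:
  "finite (Field P) \<Longrightarrow> S \<in> k_chains P k \<Longrightarrow> card S \<le> max_k_chain P k"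
  unfolding max_k_chain_def by (simp add: finite_k_chains)

text \<open>Transports a family over any finite index set to the index set \<open>{1..k}\<close>
  demanded by \<open>k_chains\<close>.\<close>

lemma UN_mem_k_chains:
  assumes "finite I" "\<And>i. i \<in> I \<Longrightarrow> C i \<in> Chains P" "disjoint_family_on C I"
  shows "(\<Union>i\<in>I. C i) \<in> k_chains P (card I)"
proof -
  define n where "n = card I"
  obtain h where h: "bij_betw h {1..n} I"
    using ex_bij_betw_nat_finite_1[OF assms(1)] unfolding n_def by blast
  then have I: "I = h ` {1..n}" and inj: "inj_on h {1..n}"
    by (auto simp: bij_betw_def)
  have "(\<Union>i\<in>I. C i) = (\<Union>i\<in>{1..n}. C (h i))" by (simp add: I)
  moreover have "\<forall>i\<in>{1..n}. C (h i) \<in> Chains P" using assms(2) by (simp add: I)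
  moreover have "disjoint_family_on (\<lambda>i. C (h i)) {1..n}"
    unfolding disjoint_family_on_def
  proof (intro ballI impI)
    fix i j assume ij: "i \<in> {1..n}" "j \<in> {1..n}" "i \<noteq> j"
    then have "h i \<noteq> h j" using inj by (auto dest: inj_onD)
    then show "C (h i) \<inter> C (h j) = {}"
      using ij assms(3) unfolding I disjoint_family_on_def by blast
  qed
  ultimately show ?thesis unfolding k_chains_def n_def by blast
qed

text \<open>The ends of the chains are the elements whose successor under \<open>s\<close> is not strictly larger.\<close>

lemma k_chain_of_successor:
  assumes po: "finite_poset P" and X: "X \<subseteq> Field P"
    and inj: "inj_on s X" and into: "s ` X \<subseteq> X"
  shows "X \<in> k_chains P (card {x \<in> X. s x = x \<or> (x, s x) \<notin> P})"
proof -
  have fin: "finite X" using po X finite_subset unfolding finite_poset_def by blast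
  have refl: "\<And>x. x \<in> Field P \<Longrightarrow> (x, x) \<in> P" and trans: "trans P" and antisym: "antisym P"
    using po unfolding finite_poset_def partial_order_on_def preorder_on_def refl_on_def by auto
  define E where "E = {x \<in> X. s x = x \<or> (x, s x) \<notin> P}"
  \<comment> \<open>\<open>R\<close> cuts the cycles of \<open>s\<close> at the elements of
    \<open>E\<close>; each remaining edge goes strictly up in \<open>P\<close>. \<open>C e\<close>
    collects the elements from which the end \<open>e\<close> is reached.\<close>
  define R where "R = {(x, s x) |x. x \<in> X - E}"
  define C where "C e = {x \<in> X. (x, e) \<in> R\<^sup>*}" for e
  have R_P: "R \<subseteq> P - Id" by (auto simp: R_def E_def)
  have R_X: "R \<subseteq> X \<times> X" using into by (auto simp: R_def)
  have sv: "single_valued R" by (auto simp: R_def single_valued_def)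
  have sv': "single_valued (R\<inverse>)"
    using inj by (auto simp: R_def single_valued_def inj_on_def)
  have star: "(x, y) \<in> P" if "(x, y) \<in> R\<^sup>*" "x \<in> X" for x y
    using that
  proof (induction rule: rtrancl_induct)
    case base
    then show ?case using refl X by blast
  next
    case (step y z)
    then show ?case using R_P trans by (meson DiffD1 subsetD transD)
  qed
  \<comment> \<open>A cycle would give both \<open>x < y\<close> and \<open>y \<le> x\<close> in
    \<open>P\<close>. With finiteness this makes the converse of \<open>R\<close> well-founded, so
    following \<open>s\<close> upwards always stops at an end.\<close>
  have "acyclic R"
  proof (rule acyclicI, intro allI notI)
    fix x assume "(x, x) \<in> R\<^sup>+"
    then obtain y where y: "(x, y) \<in> R" "(y, x) \<in> R\<^sup>*" by (meson tranclD)
    then show False using star[of y x] R_P R_X antisym by (auto dest: antisymD)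
  qed
  moreover have finR: "finite R" using R_X fin finite_subset by blast
  ultimately have wf: "wf (R\<inverse>)" by (simp add: finite_acyclic_wf_converse)
  have chain: "C e \<in> Chains P" for e
    unfolding Chains_def
  proof (rule CollectI, intro ballI)
    fix x y assume "x \<in> C e" "y \<in> C e"
    then have xy: "x \<in> X" "y \<in> X" and "(e, x) \<in> (R\<inverse>)\<^sup>*" "(e, y) \<in> (R\<inverse>)\<^sup>*"
      by (auto simp: C_def rtrancl_converse)
    \<comment> \<open>Injectivity of \<open>s\<close> makes backward paths from \<open>e\<close>
      unique, so one of the two elements lies on the path of the other.\<close>
    then have "(x, y) \<in> (R\<inverse>)\<^sup>* \<or> (y, x) \<in> (R\<inverse>)\<^sup>*" using single_valued_confluent sv' by metis
    then show "(x, y) \<in> P \<or> (y, x) \<in> P" using star xy by (auto simp: rtrancl_converse)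
  qed
  have end_stuck: "e = y" if "e \<in> E" "(e, y) \<in> R\<^sup>*" for e y
    using that(2,1) by (cases rule: converse_rtranclE) (auto simp: R_def)
  have disj: "disjoint_family_on C E"
    unfolding disjoint_family_on_def
  proof (intro ballI impI, rule ccontr)
    fix e e' assume e: "e \<in> E" "e' \<in> E" "e \<noteq> e'" and "C e \<inter> C e' \<noteq> {}"
    then obtain x where "(x, e) \<in> R\<^sup>*" "(x, e') \<in> R\<^sup>*" by (auto simp: C_def)
    \<comment> \<open>Forward paths from \<open>x\<close> are unique as well, and an end has no
      outgoing edge, so \<open>x\<close> cannot lead to two ends.\<close>
    then show False using single_valued_confluent[OF sv] end_stuck e by metis
  qed
  have "\<exists>e\<in>E. (x, e) \<in> R\<^sup>*" if "x \<in> X" for x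
    using wf that
  proof (induction x rule: wf_induct_rule)
    case (less x)
    show ?case
    proof (cases "x \<in> E")
      case False
      then have "(x, s x) \<in> R" using less.prems by (auto simp: R_def)
      then show ?thesis using less.IH[of "s x"] R_X by (auto intro: converse_rtrancl_into_rtrancl)
    qed auto
  qed
  then have "X = (\<Union>e\<in>E. C e)" unfolding C_def by blast
  moreover have "finite E" using fin by (simp add: E_def)
  ultimately show ?thesis using UN_mem_k_chains[of E C P] chain disj unfolding E_def by metis
qed

text \<open>Equal primal and dual values in the assignment problem tie the chains of a permutation
  to a \<open>k\<close>-antichain. The bound says that \<open>k * m\<close> plus the number of
  elements outside \<open>X\<close> is at most \<open>max_k_antichain P k\<close>, written
  additively to avoid truncated subtraction.\<close>

lemma greene_kleitman:
  assumes po: "finite_poset P" and k: "k > 0"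
  obtains m X where "X \<in> k_chains P m"
    and "card (Field P) + k * m \<le> max_k_antichain P k + card X"
proof (cases "Field P = {}")
  case True
  then show thesis using that[of "{}" 0] UN_mem_k_chains[of "{}" "\<lambda>_. {}" P]
    by (simp add: disjoint_family_on_def)
next
  case ne: False
  let ?V = "Field P"
  have fin: "finite ?V" using po by (simp add: finite_poset_def)
  define w where "w x y = (if x = y then int k - 1 else if (x, y) \<in> P then int k else 0)" for x y
  obtain u v s where feas: "\<And>x y. x \<in> ?V \<Longrightarrow> y \<in> ?V \<Longrightarrow> w x y \<le> u x + v y"
    and s: "bij_betw s ?V ?V" and tight: "\<And>x. x \<in> ?V \<Longrightarrow> w x (s x) = u x + v (s x)"
    using assignment_duality[of ?V w] fin k unfolding w_def by auto
  define S where "S = {x \<in> ?V. u x + v x = int k - 1}"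
  \<comment> \<open>At a minimiser \<open>y0\<close> of \<open>v\<close>, feasibility and
    nonnegative weights give \<open>u x \<ge> - c\<close>. On \<open>S\<close> this confines
    \<open>v x - c\<close> to the range from 0 to \<open>k - 1\<close>, so there are at most
    \<open>k\<close> levels; \<open>A i\<close> is level \<open>i - 1\<close>.\<close>
  define c where "c = Min (v ` ?V)"
  have c_le: "c \<le> v x" if "x \<in> ?V" for x using that fin by (simp add: c_def)
  have "c \<in> v ` ?V" unfolding c_def using fin ne by (intro Min_in) auto
  then obtain y0 where y0: "y0 \<in> ?V" "v y0 = c" by blast
  have u_ge: "- c \<le> u x" if "x \<in> ?V" for x
    using feas[OF that y0(1)] y0(2) k by (auto simp: w_def split: if_splits)
  define A where "A i = {x \<in> S. v x - c = int i - 1}" for i :: nat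
  have anti: "A i \<in> antichains P" for i
  proof -
    have "x = y" if xy: "x \<in> A i" "y \<in> A i" "(x, y) \<in> P" for x y
    proof (rule ccontr)
      assume "x \<noteq> y"
      \<comment> \<open>On one level \<open>v y = v x\<close>, so the right-hand side is
        \<open>k - 1\<close>.\<close>
      then have "int k \<le> u x + v y" using feas[of x y] xy by (auto simp: w_def A_def S_def)
      then show False using xy by (auto simp: A_def S_def)
    qed
    moreover have "A i \<subseteq> ?V" by (auto simp: A_def S_def)
    ultimately show ?thesis unfolding antichains_def by blast
  qed
  have "S \<subseteq> (\<Union>i\<in>{1..k}. A i)"
  proof
    fix x assume x: "x \<in> S"
    then have xV: "x \<in> ?V" and eq: "u x + v x = int k - 1" by (auto simp: S_def)
    have "x \<in> A (nat (v x - c + 1))" using x c_le[OF xV] by (simp add: A_def)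
    moreover have "nat (v x - c + 1) \<in> {1..k}" using c_le[OF xV] u_ge[OF xV] eq by auto
    ultimately show "x \<in> (\<Union>i\<in>{1..k}. A i)" by blast
  qed
  then have "S = (\<Union>i\<in>{1..k}. A i)" by (auto simp: A_def)
  then have "S \<in> k_antichains P k" using anti unfolding k_antichains_def by blast
  then have dS: "card S \<le> max_k_antichain P k" by (rule card_le_max_k_antichain[OF fin])
  define X where "X = {x \<in> ?V. s x \<noteq> x}"
  define E where "E = {x \<in> X. s x = x \<or> (x, s x) \<notin> P}"
  have inj: "inj_on s ?V" and sV: "\<And>x. x \<in> ?V \<Longrightarrow> s x \<in> ?V"
    using s by (auto simp: bij_betw_def)
  have XV: "X \<subseteq> ?V" by (auto simp: X_def)
  \<comment> \<open>If \<open>s x\<close> were fixed, injectivity would make \<open>x\<close> fixed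
    too.\<close>
  have "s ` X \<subseteq> X" using inj sV by (auto simp: X_def inj_on_def)
  then have "X \<in> k_chains P (card E)"
    unfolding E_def using k_chain_of_successor[OF po XV] inj_on_subset[OF inj XV] by blast
  moreover have "card ?V + k * card E \<le> max_k_antichain P k + card X"
  proof -
    have EX: "E \<subseteq> ?V" by (auto simp: E_def X_def)
    \<comment> \<open>The weight is \<open>k - 1\<close> at a fixed point, \<open>k\<close> at a
      chain link and 0 at a chain end.\<close>
    have "(\<Sum>x\<in>?V. w x (s x)) =
        (\<Sum>x\<in>?V. int k - 1 + of_bool (x \<in> X) - int k * of_bool (x \<in> E))"
      by (rule sum.cong) (auto simp: w_def X_def E_def)
    also have "\<dots> = (int k - 1) * int (card ?V) + int (card X) - int k * int (card E)"
      by (simp only: sum.distrib sum_subtractf sum_distrib_left[symmetric]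
          sum_of_bool_mem[OF fin XV] sum_of_bool_mem[OF fin EX])
        (simp add: algebra_simps)
    finally have lhs: "(\<Sum>x\<in>?V. w x (s x)) = \<dots>" .
    have SV: "S \<subseteq> ?V" by (auto simp: S_def)
    \<comment> \<open>The diagonal constraint gives \<open>u x + v x \<ge> k - 1\<close>, with
      equality exactly on \<open>S\<close>; integrality raises the bound to \<open>k\<close>
      elsewhere.\<close>
    have "int k * int (card ?V) - int (card S) = (\<Sum>x\<in>?V. int k - of_bool (x \<in> S))"
      by (simp only: sum_subtractf sum_of_bool_mem[OF fin SV]) simp
    also have "\<dots> \<le> (\<Sum>x\<in>?V. u x + v x)"
    proof (rule sum_mono)
      fix x assume x: "x \<in> ?V"
      show "int k - of_bool (x \<in> S) \<le> u x + v x"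
        using feas[OF x x] x by (auto simp: w_def S_def)
    qed
    also have "\<dots> = (\<Sum>x\<in>?V. u x) + (\<Sum>x\<in>?V. v (s x))"
      using sum.reindex_bij_betw[OF s, of v] by (simp add: sum.distrib)
    also have "\<dots> = (\<Sum>x\<in>?V. w x (s x))" using tight by (simp add: sum.distrib)
    also note lhs
    finally have "int (card ?V) + int k * int (card E) \<le> int (card S) + int (card X)"
      by (simp add: algebra_simps)
    then have "card ?V + k * card E \<le> card S + card X"
      by (metis of_nat_add of_nat_le_iff of_nat_mult)
    then show ?thesis using dS by linarith
  qed
  ultimately show thesis by (rule that)
qed

section \<open>Elementary properties of the numbers \<open>d_k\<close> and
  \<open>c_k\<close>\<close>

lemma k_antichains_0: "k_antichains P 0 = {{}}"
  by (simp add: k_antichains_def)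

lemma max_k_antichain_0: "max_k_antichain P 0 = 0"
  by (simp add: max_k_antichain_def k_antichains_0)

lemma k_antichains_Suc_mono: "k_antichains P k \<subseteq> k_antichains P (Suc k)"
proof
  fix S assume "S \<in> k_antichains P k"
  then obtain A where S: "S = (\<Union>i\<in>{1..k}. A i)" and A: "\<forall>i\<in>{1..k}. A i \<in> antichains P"
    unfolding k_antichains_def by blast
  have "S = (\<Union>i\<in>{1..Suc k}. if i \<le> k then A i else {})"
    unfolding S by (fastforce split: if_splits)
  moreover have "\<forall>i\<in>{1..Suc k}. (if i \<le> k then A i else {}) \<in> antichains P"
    using A by (auto simp: antichains_def)
  ultimately show "S \<in> k_antichains P (Suc k)"
    unfolding k_antichains_def by blast
qed

lemma k_antichains_nonempty: "k_antichains P k \<noteq> {}"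
proof (induction k)
  case 0
  then show ?case by (simp add: k_antichains_0)
next
  case (Suc k)
  then show ?case using k_antichains_Suc_mono[of P k] by auto
qed

lemma max_k_antichain_attained:
  assumes "finite (Field P)"
  obtains S where "S \<in> k_antichains P k" "max_k_antichain P k = card S"
proof -
  have "max_k_antichain P k \<in> card ` k_antichains P k"
    unfolding max_k_antichain_def
    using finite_k_antichains[OF assms] k_antichains_nonempty by (intro Max_in) auto
  then show thesis using that by blast
qed

lemma max_k_antichain_mono:
  assumes "finite (Field P)" "k \<le> l"
  shows "max_k_antichain P k \<le> max_k_antichain P l"
proof -
  have "max_k_antichain P k \<le> max_k_antichain P (Suc k)" for k
    unfolding max_k_antichain_def
    using k_antichains_nonempty finite_k_antichains[OF assms(1)]
    by (intro Max_mono image_mono k_antichains_Suc_mono) auto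
  then show ?thesis using assms(2) lift_Suc_mono_le by blast
qed

lemma max_k_antichain_le_card:
  assumes "finite (Field P)"
  shows "max_k_antichain P k \<le> card (Field P)"
proof -
  obtain S where "S \<in> k_antichains P k" "max_k_antichain P k = card S"
    using max_k_antichain_attained[OF assms] .
  then show ?thesis using card_mono[OF assms k_antichains_subset_Field] by simp
qed

lemma max_k_antichain_eq_sum:
  assumes "finite (Field P)"
  shows "max_k_antichain P k = (\<Sum>i = 1..k. greene_mu P i)"
proof (induction k)
  case 0
  then show ?case by (simp add: max_k_antichain_0)
next
  case (Suc k)
  then show ?case
    using max_k_antichain_mono[OF assms, of k "Suc k"] by (simp add: greene_mu_def)
qed

lemma max_k_chain_le_card:
  assumes "finite (Field P)"
  shows "max_k_chain P k \<le> card (Field P)"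
proof -
  have "(\<Union>i\<in>{1..k}. {}) \<in> k_chains P (card {1..k})"
    by (rule UN_mem_k_chains) (auto simp: Chains_def disjoint_family_on_def)
  then have "max_k_chain P k \<in> card ` k_chains P k"
    unfolding max_k_chain_def using finite_k_chains[OF assms] by (intro Max_in) auto
  then obtain S where "S \<in> k_chains P k" "max_k_chain P k = card S" by blast
  then show ?thesis using card_mono[OF assms k_chains_subset_Field] by simp
qed

section \<open>Decomposable posets\<close>

lemma d_decomposition:
  assumes po: "finite_poset P" and d: "d_decomposable P"
  obtains A where "\<And>i. i \<in> {1..height P} \<Longrightarrow> A i \<in> antichains P"
    and "disjoint_family_on A {1..height P}"
    and "\<And>i. i \<in> {1..height P} \<Longrightarrow> card (A i) = greene_mu P i"
    and "\<And>i. height P < i \<Longrightarrow> greene_mu P i = 0"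
proof -
  let ?h = "height P"
  have fin: "finite (Field P)" using po by (simp add: finite_poset_def)
  obtain A where all: "\<forall>i\<in>{1..?h}. A i \<in> antichains P \<and> A i \<noteq> {}"
    and disj: "disjoint_family_on A {1..?h}" and un: "(\<Union>i\<in>{1..?h}. A i) = Field P"
    and cards: "\<forall>k\<in>{1..?h}. card (\<Union>i\<in>{1..k}. A i) = max_k_antichain P k"
    using d unfolding d_decomposable_def by (elim exE conjE)
  have A: "\<And>i. i \<in> {1..?h} \<Longrightarrow> A i \<in> antichains P" using all by blast
  have finA: "finite (A i)" if "i \<in> {1..?h}" for i
    using A[OF that] fin unfolding antichains_def by (auto intro: finite_subset)
  have d: "max_k_antichain P k = (\<Sum>i = 1..k. card (A i))" if "k \<le> ?h" for k
  proof (cases "k = 0")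
    case False
    have "card (\<Union>i\<in>{1..k}. A i) = (\<Sum>i = 1..k. card (A i))"
      using disj finA that unfolding disjoint_family_on_def
      by (intro card_UN_disjoint) auto
    then show ?thesis using cards that False by simp
  qed (simp add: max_k_antichain_0)
  have "card (A i) = greene_mu P i" if "i \<in> {1..?h}" for i
    using d[of i] d[of "i - 1"] that unfolding greene_mu_def by (cases i) auto
  moreover have "greene_mu P i = 0" if "?h < i" for i
  proof -
    \<comment> \<open>The antichains up to the height already exhaust \<open>P\<close>, so
      \<open>d_k\<close> is constant from there on. Height 0 is separate because the cardinality
      condition starts at \<open>k = 1\<close>.\<close>
    have "card (Field P) \<le> max_k_antichain P ?h"
    proof (cases "?h = 0")
      case True
      then show ?thesis using un by simp
    next
      case False
      then have "?h \<in> {1..?h}" by simp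
      then show ?thesis using cards un by (metis order_refl)
    qed
    also have "\<dots> \<le> max_k_antichain P (i - 1)"
      using that by (intro max_k_antichain_mono[OF fin]) auto
    finally show ?thesis
      using max_k_antichain_le_card[OF fin, of i] by (simp add: greene_mu_def)
  qed
  ultimately show thesis using that A disj by blast
qed

lemma c_decomposition:
  assumes po: "finite_poset P" and c: "c_decomposable P"
  obtains C where "\<And>i. i \<in> {1..width P} \<Longrightarrow> C i \<in> Chains P"
    and "\<And>i. i \<in> {1..width P} \<Longrightarrow> C i \<noteq> {}"
    and "disjoint_family_on C {1..width P}"
    and "(\<Union>i\<in>{1..width P}. C i) = Field P"
    and "\<And>i. i \<in> {1..width P} \<Longrightarrow> card (C i) = greene_lambda P i"
    and "\<And>k. k \<le> width P \<Longrightarrow> max_k_chain P k = (\<Sum>i = 1..k. card (C i))"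
proof -
  let ?w = "width P"
  have fin: "finite (Field P)" using po by (simp add: finite_poset_def)
  obtain C where all: "\<forall>i\<in>{1..?w}. C i \<in> Chains P \<and> C i \<noteq> {}"
    and disj: "disjoint_family_on C {1..?w}" and un: "(\<Union>i\<in>{1..?w}. C i) = Field P"
    and cards: "\<forall>k\<in>{1..?w}. card (\<Union>i\<in>{1..k}. C i) = max_k_chain P k"
    using c unfolding c_decomposable_def by (elim exE conjE)
  have C: "\<And>i. i \<in> {1..?w} \<Longrightarrow> C i \<in> Chains P"
    and ne: "\<And>i. i \<in> {1..?w} \<Longrightarrow> C i \<noteq> {}"
    using all by blast+
  have finC: "finite (C i)" if "i \<in> {1..?w}" for i
    using Chains_subset_Field[OF C[OF that]] fin by (auto intro: finite_subset)
  have d: "max_k_chain P k = (\<Sum>i = 1..k. card (C i))" if "k \<le> ?w" for k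
  proof (cases "k = 0")
    case True
    have "k_chains P 0 = {{}}" by (auto simp: k_chains_def disjoint_family_on_def)
    then show ?thesis using True by (simp add: max_k_chain_def)
  next
    case False
    have "card (\<Union>i\<in>{1..k}. C i) = (\<Sum>i = 1..k. card (C i))"
      using disj finC that unfolding disjoint_family_on_def
      by (intro card_UN_disjoint) auto
    then show ?thesis using cards that False by simp
  qed
  have "card (C i) = greene_lambda P i" if "i \<in> {1..?w}" for i
    using d[of i] d[of "i - 1"] that unfolding greene_lambda_def by (cases i) auto
  then show thesis using that C ne disj un d by blast
qed

section \<open>Conjugacy of \<open>\<lambda>\<close> and \<open>\<mu>\<close>, and equality of the
  two sums\<close>

lemma card_k_antichain_Int_chain_le:
  assumes "S \<in> k_antichains P k" "C \<in> Chains P"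
  shows "card (S \<inter> C) \<le> k"
proof -
  obtain A where S: "S = (\<Union>i\<in>{1..k}. A i)" and A: "\<forall>i\<in>{1..k}. A i \<in> antichains P"
    using assms(1) unfolding k_antichains_def by blast
  have "card (A i \<inter> C) \<le> 1" if "i \<in> {1..k}" for i
  proof -
    have "\<forall>x\<in>A i \<inter> C. \<forall>y\<in>A i \<inter> C. x = y"
      using A that assms(2) unfolding antichains_def Chains_def by blast
    then show ?thesis using card_le_Suc0_iff_eq card.infinite by (metis One_nat_def le0)
  qed
  then have "(\<Sum>i = 1..k. card (A i \<inter> C)) \<le> (\<Sum>i = 1..k. 1)" by (rule sum_mono)
  moreover have "card (\<Union>i\<in>{1..k}. A i \<inter> C) \<le> (\<Sum>i = 1..k. card (A i \<inter> C))"
    by (rule card_UN_le) simp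
  moreover have "S \<inter> C = (\<Union>i\<in>{1..k}. A i \<inter> C)" unfolding S by blast
  ultimately show ?thesis by simp
qed

text \<open>The inequality \<open>\<ge>\<close> is the half of Greene's duality that needs the existence of
  \<open>k\<close>-saturated chain families.\<close>

lemma max_k_antichain_eq_sum_min_lambda:
  assumes po: "finite_poset P" and c: "c_decomposable P"
  shows "max_k_antichain P k = (\<Sum>j = 1..width P. min (greene_lambda P j) k)"
proof (cases "k = 0")
  case True
  then show ?thesis by (simp add: max_k_antichain_0)
next
  case False
  let ?w = "width P"
  have fin: "finite (Field P)" using po by (simp add: finite_poset_def)
  obtain C where C: "\<And>i. i \<in> {1..?w} \<Longrightarrow> C i \<in> Chains P"
    and disj: "disjoint_family_on C {1..?w}" and un: "(\<Union>i\<in>{1..?w}. C i) = Field P"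
    and card_C: "\<And>i. i \<in> {1..?w} \<Longrightarrow> card (C i) = greene_lambda P i"
    and ck: "\<And>k. k \<le> ?w \<Longrightarrow> max_k_chain P k = (\<Sum>i = 1..k. card (C i))"
    using c_decomposition[OF po c] by metis
  have finC: "finite (C i)" if "i \<in> {1..?w}" for i
    using Chains_subset_Field[OF C[OF that]] fin by (auto intro: finite_subset)
  have n: "card (Field P) = (\<Sum>i = 1..?w. card (C i))"
    unfolding un[symmetric] using disj finC unfolding disjoint_family_on_def
    by (intro card_UN_disjoint) auto
  have "max_k_antichain P k \<le> (\<Sum>j = 1..?w. min (card (C j)) k)"
  proof -
    obtain S where S: "S \<in> k_antichains P k" "max_k_antichain P k = card S"
      using max_k_antichain_attained[OF fin] .
    have "S = (\<Union>j\<in>{1..?w}. S \<inter> C j)" using k_antichains_subset_Field[OF S(1)] un by blast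
    then have "card S \<le> (\<Sum>j = 1..?w. card (S \<inter> C j))"
      using card_UN_le[of "{1..?w}" "\<lambda>j. S \<inter> C j"] by simp
    also have "\<dots> \<le> (\<Sum>j = 1..?w. min (card (C j)) k)"
      using card_k_antichain_Int_chain_le[OF S(1) C] card_mono[OF finC]
      by (intro sum_mono) simp
    finally show ?thesis using S(2) by simp
  qed
  moreover have "(\<Sum>j = 1..?w. min (card (C j)) k) \<le> max_k_antichain P k"
  proof -
    obtain m X where X: "X \<in> k_chains P m"
      and le: "card (Field P) + k * m \<le> max_k_antichain P k + card X"
      using greene_kleitman[OF po, of k] False by blast
    have cX: "card X \<le> max_k_chain P m" using card_le_max_k_chain[OF fin X] .
    show ?thesis
    \<comment> \<open>For \<open>m \<le> ?w\<close>, bound the first \<open>m\<close> terms by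
      \<open>k\<close> and the others by \<open>card (C j)\<close>; the latter add up to
      \<open>card (Field P) - max_k_chain P m\<close>, at most the number of elements outside
      \<open>X\<close>. For larger \<open>m\<close> the term \<open>k * m\<close> alone suffices, as
      \<open>card X \<le> card (Field P)\<close>.\<close>
    proof (cases "m \<le> ?w")
      case True
      then have split: "sum f {1..?w} = sum f {1..m} + sum f {m+1..?w}" for f :: "nat \<Rightarrow> nat"
        using sum.ub_add_nat[of 1 m f "?w - m"] by simp
      have "(\<Sum>j = 1..m. min (card (C j)) k) \<le> (\<Sum>j = 1..m. k)" by (rule sum_mono) simp
      moreover have "(\<Sum>j = m+1..?w. min (card (C j)) k) \<le> (\<Sum>j = m+1..?w. card (C j))"
        by (rule sum_mono) simp
      ultimately show ?thesis
        using le cX ck[OF True] n split[of "\<lambda>j. card (C j)"] split[of "\<lambda>j. min (card (C j)) k"]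
        by (simp add: mult.commute)
    next
      case False
      have "(\<Sum>j = 1..?w. min (card (C j)) k) \<le> (\<Sum>j = 1..?w. k)" by (rule sum_mono) simp
      also have "\<dots> \<le> k * m" using False by simp
      also have "\<dots> \<le> max_k_antichain P k"
        using le cX max_k_chain_le_card[OF fin, of m] by linarith
      finally show ?thesis .
    qed
  qed
  ultimately show ?thesis using card_C by simp
qed

text \<open>Raising the cap from \<open>k - 1\<close> to \<open>k\<close> in the sum of the
  \<open>min (greene_lambda P j) k\<close> adds one for each part of size at least
  \<open>k\<close>.\<close>

lemma greene_mu_eq_card_lambda:
  assumes po: "finite_poset P" and c: "c_decomposable P" and k: "k \<ge> 1"
  shows "greene_mu P k = card {j \<in> {1..width P}. k \<le> greene_lambda P j}"
proof -
  let ?l = "greene_lambda P" and ?J = "{1..width P}"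
  have "max_k_antichain P k = (\<Sum>j\<in>?J. min (?l j) (k - 1) + of_bool (k \<le> ?l j))"
    unfolding max_k_antichain_eq_sum_min_lambda[OF po c] using k
    by (intro sum.cong) auto
  also have "\<dots> = max_k_antichain P (k - 1) + card {j \<in> ?J. k \<le> ?l j}"
    unfolding max_k_antichain_eq_sum_min_lambda[OF po c]
    by (simp add: sum.distrib Int_def)
  finally show ?thesis by (simp add: greene_mu_def)
qed

text \<open>Double counting: expand each \<open>d\<close> of \<open>Q\<close> as a sum of
  \<open>\<mu>\<close> values and exchange the sums; index \<open>i\<close> then occurs once for
  every part of \<open>\<lambda>\<close> of size at least \<open>i\<close>, that is,
  \<open>greene_mu P i\<close> times.\<close>

lemma sum_max_k_antichain_lambda:
  assumes P: "finite_poset P" "d_decomposable P" "c_decomposable P"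
    and Q: "finite_poset Q" "d_decomposable Q"
  shows "(\<Sum>j = 1..width P. max_k_antichain Q (greene_lambda P j)) =
    (\<Sum>i = 1..min (height P) (height Q). greene_mu P i * greene_mu Q i)"
proof -
  let ?l = "greene_lambda P" and ?J = "{1..width P}"
  \<comment> \<open>\<open>N\<close> bounds all parts and both heights, so every sum over
    \<open>i\<close> extends to \<open>{1..N}\<close> by zero terms.\<close>
  define N where "N = max (Max (insert 0 (?l ` ?J))) (max (height P) (height Q))"
  have l_le: "?l j \<le> N" if "j \<in> ?J" for j
    using that unfolding N_def by (intro max.coboundedI1 Max_ge) auto
  have finQ: "finite (Field Q)" using Q by (simp add: finite_poset_def)
  have mu0: "greene_mu P i = 0" if "height P < i" for i
    using d_decomposition[OF P(1,2)] that by metis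
  have mu0': "greene_mu Q i = 0" if "height Q < i" for i
    using d_decomposition[OF Q] that by metis
  have "(\<Sum>j\<in>?J. max_k_antichain Q (?l j)) =
      (\<Sum>j\<in>?J. \<Sum>i = 1..N. of_bool (i \<le> ?l j) * greene_mu Q i)"
  proof (rule sum.cong[OF refl])
    fix j assume j: "j \<in> ?J"
    have "(\<Sum>i = 1..?l j. greene_mu Q i) = (\<Sum>i = 1..N. of_bool (i \<le> ?l j) * greene_mu Q i)"
      using l_le[OF j] by (intro sum.mono_neutral_cong_left) auto
    then show "max_k_antichain Q (?l j) = \<dots>" by (simp add: max_k_antichain_eq_sum[OF finQ])
  qed
  also have "\<dots> = (\<Sum>i = 1..N. (\<Sum>j\<in>?J. of_bool (i \<le> ?l j)) * greene_mu Q i)"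
    by (subst sum.swap) (simp only: sum_distrib_right)
  also have "\<dots> = (\<Sum>i = 1..N. greene_mu P i * greene_mu Q i)"
    by (intro sum.cong) (auto simp: greene_mu_eq_card_lambda[OF P(1,3)] Int_def)
  also have "\<dots> = (\<Sum>i = 1..min (height P) (height Q). greene_mu P i * greene_mu Q i)"
    using mu0 mu0' by (intro sum.mono_neutral_right) (auto simp: N_def min_def not_le)
  finally show ?thesis .
qed

section \<open>Unichains and semiantichains\<close>

lemma vertical_mem_unichains:
  assumes "finite_poset P" "p \<in> Field P" "C \<in> Chains Q"
  shows "{p} \<times> C \<in> unichains P Q"
proof -
  have "(p, p) \<in> P"
    using assms(1,2) by (simp add: finite_poset_def partial_order_on_def preorder_on_def refl_on_def)
  then have "{p} \<times> C \<in> Chains (prod_poset P Q)"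
    using assms(3) unfolding Chains_def prod_poset_def by blast
  then show ?thesis using assms unfolding unichains_def by blast
qed

lemma horizontal_mem_unichains:
  assumes "finite_poset Q" "q \<in> Field Q" "C \<in> Chains P"
  shows "C \<times> {q} \<in> unichains P Q"
proof -
  have "(q, q) \<in> Q"
    using assms(1,2) by (simp add: finite_poset_def partial_order_on_def preorder_on_def refl_on_def)
  then have "C \<times> {q} \<in> Chains (prod_poset P Q)"
    using assms(3) unfolding Chains_def prod_poset_def by blast
  then show ?thesis using assms unfolding unichains_def by blast
qed

lemma unichains_subset: "U \<in> unichains P Q \<Longrightarrow> U \<subseteq> Field P \<times> Field Q"
proof -
  assume "U \<in> unichains P Q"
  then consider p C where "p \<in> Field P" "C \<in> Chains Q" "U = {p} \<times> C"
    | q C where "q \<in> Field Q" "C \<in> Chains P" "U = C \<times> {q}"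
    unfolding unichains_def by blast
  then show ?thesis
  proof cases
    case 1
    then show ?thesis using Chains_subset_Field[OF 1(2)] by auto
  next
    case 2
    then show ?thesis using Chains_subset_Field[OF 2(2)] by auto
  qed
qed

lemma finite_unichains:
  assumes "finite_poset P" "finite_poset Q"
  shows "finite (unichains P Q)"
proof (rule finite_subset)
  show "unichains P Q \<subseteq> Pow (Field P \<times> Field Q)" using unichains_subset by blast
qed (use assms in \<open>simp add: finite_poset_def\<close>)

lemma unichain_cover_chain_times:
  assumes P: "finite_poset P" and Q: "finite_poset Q" and C: "C \<in> Chains P" "C \<noteq> {}"
  obtains \<U> where "\<U> \<subseteq> unichains P Q" "\<Union>\<U> = C \<times> Field Q"
    "card \<U> \<le> max_k_antichain Q (card C)"
proof -
  have finP: "finite (Field P)" and finQ: "finite (Field Q)"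
    using P Q by (simp_all add: finite_poset_def)
  have CF: "C \<subseteq> Field P" using C(1) by (rule Chains_subset_Field)
  then have finC: "finite C" using finP finite_subset by blast
  have "card C > 0" using C(2) finC by (simp add: card_gt_0_iff)
  obtain m X where X: "X \<in> k_chains Q m"
    and le: "card (Field Q) + card C * m \<le> max_k_antichain Q (card C) + card X"
    using greene_kleitman[OF Q \<open>card C > 0\<close>] .
  obtain D where XD: "X = (\<Union>i\<in>{1..m}. D i)" and D: "\<forall>i\<in>{1..m}. D i \<in> Chains Q"
    using X unfolding k_chains_def by blast
  have XF: "X \<subseteq> Field Q" using X by (rule k_chains_subset_Field)
  \<comment> \<open>\<open>?V\<close> has at most \<open>card C * m\<close> members and
    \<open>?H\<close> at most one per element outside \<open>X\<close>: the quantity bounded by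
    \<open>le\<close>.\<close>
  let ?V = "(\<lambda>(p, i). {p} \<times> D i) ` (C \<times> {1..m})"
  let ?H = "(\<lambda>q. C \<times> {q}) ` (Field Q - X)"
  have "?V \<union> ?H \<subseteq> unichains P Q"
    using D CF
    by (auto intro!: vertical_mem_unichains[OF P] horizontal_mem_unichains[OF Q _ C(1)])
  moreover have "\<Union>(?V \<union> ?H) = C \<times> Field Q"
  proof -
    have V: "\<Union>?V = C \<times> X" unfolding XD by auto
    have H: "\<Union>?H = C \<times> (Field Q - X)" by auto
    have "C \<times> X \<union> C \<times> (Field Q - X) = C \<times> Field Q" using XF by blast
    then show ?thesis unfolding Union_Un_distrib V H .
  qed
  moreover have "card (?V \<union> ?H) \<le> max_k_antichain Q (card C)"
  proof -
    have "card ?V \<le> card C * m"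
      using card_image_le[of "C \<times> {1..m}" "\<lambda>(p, i). {p} \<times> D i"] finC
      by (simp add: card_cartesian_product)
    moreover have "card ?H \<le> card (Field Q) - card X"
      using card_image_le[of "Field Q - X" "\<lambda>q. C \<times> {q}"] finQ XF
      by (simp add: card_Diff_subset finite_subset)
    moreover have "card X \<le> card (Field Q)" using XF finQ by (rule card_mono[rotated])
    moreover have "card (?V \<union> ?H) \<le> card ?V + card ?H" by (rule card_Un_le)
    ultimately show ?thesis using le by linarith
  qed
  ultimately show thesis by (rule that)
qed

lemma unichain_covering_exists:
  assumes P: "finite_poset P" "c_decomposable P" and Q: "finite_poset Q"
  obtains \<U> where "\<U> \<in> unichain_coverings P Q"
    "card \<U> \<le> (\<Sum>j = 1..width P. max_k_antichain Q (greene_lambda P j))"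
proof -
  let ?J = "{1..width P}"
  obtain C where C: "\<And>j. j \<in> ?J \<Longrightarrow> C j \<in> Chains P" "\<And>j. j \<in> ?J \<Longrightarrow> C j \<noteq> {}"
    and un: "(\<Union>j\<in>?J. C j) = Field P"
    and card_C: "\<And>j. j \<in> ?J \<Longrightarrow> card (C j) = greene_lambda P j"
    using c_decomposition[OF P] by metis
  have "\<exists>\<U>. \<U> \<subseteq> unichains P Q \<and> \<Union>\<U> = C j \<times> Field Q \<and>
      card \<U> \<le> max_k_antichain Q (greene_lambda P j)" if "j \<in> ?J" for j
    using unichain_cover_chain_times[OF P(1) Q C(1,2)[OF that]] card_C[OF that] by metis
  then obtain \<U> where \<U>: "\<And>j. j \<in> ?J \<Longrightarrow> \<U> j \<subseteq> unichains P Q"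
    "\<And>j. j \<in> ?J \<Longrightarrow> \<Union>(\<U> j) = C j \<times> Field Q"
    "\<And>j. j \<in> ?J \<Longrightarrow> card (\<U> j) \<le> max_k_antichain Q (greene_lambda P j)"
    by metis
  have "\<Union>(\<Union>j\<in>?J. \<U> j) = (\<Union>j\<in>?J. \<Union>(\<U> j))" by blast
  also have "\<dots> = (\<Union>j\<in>?J. C j \<times> Field Q)" using \<U>(2) by simp
  also have "\<dots> = Field P \<times> Field Q" using un by blast
  finally have "(\<Union>j\<in>?J. \<U> j) \<in> unichain_coverings P Q"
    using \<U>(1) unfolding unichain_coverings_def by blast
  moreover have "card (\<Union>j\<in>?J. \<U> j) \<le> (\<Sum>j\<in>?J. card (\<U> j))" by (rule card_UN_le) simp
  then have "card (\<Union>j\<in>?J. \<U> j) \<le> (\<Sum>j\<in>?J. max_k_antichain Q (greene_lambda P j))"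
    by (rule order_trans) (rule sum_mono[OF \<U>(3)])
  ultimately show thesis by (rule that)
qed

text \<open>Pairing antichains of equal index works because one coordinate determines the index: if
  two elements agree in one coordinate, their other coordinates lie in the same antichain and cannot
  be distinct and comparable.\<close>

lemma semiantichain_exists:
  assumes P: "finite_poset P" "d_decomposable P" and Q: "finite_poset Q" "d_decomposable Q"
  obtains S where "S \<in> semiantichains P Q"
    "card S = (\<Sum>i = 1..min (height P) (height Q). greene_mu P i * greene_mu Q i)"
proof -
  let ?I = "{1..min (height P) (height Q)}"
  obtain A where A: "\<And>i. i \<in> {1..height P} \<Longrightarrow> A i \<in> antichains P"
    "disjoint_family_on A {1..height P}"
    "\<And>i. i \<in> {1..height P} \<Longrightarrow> card (A i) = greene_mu P i"
    using d_decomposition[OF P] by metis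
  obtain B where B: "\<And>i. i \<in> {1..height Q} \<Longrightarrow> B i \<in> antichains Q"
    "disjoint_family_on B {1..height Q}"
    "\<And>i. i \<in> {1..height Q} \<Longrightarrow> card (B i) = greene_mu Q i"
    using d_decomposition[OF Q] by metis
  have sub: "A i \<subseteq> Field P" "B i \<subseteq> Field Q" if "i \<in> ?I" for i
    using A(1)[of i] B(1)[of i] that unfolding antichains_def by auto
  have fin: "finite (A i)" "finite (B i)" if "i \<in> ?I" for i
    using sub[OF that] P Q finite_subset unfolding finite_poset_def by blast+
  have sameA: "i = j" if "i \<in> ?I" "j \<in> ?I" "p \<in> A i" "p \<in> A j" for i j p
    using A(2) that unfolding disjoint_family_on_def by fastforce
  have sameB: "i = j" if "i \<in> ?I" "j \<in> ?I" "q \<in> B i" "q \<in> B j" for i j q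
    using B(2) that unfolding disjoint_family_on_def by fastforce
  have antiA: "x = y" if "i \<in> ?I" "x \<in> A i" "y \<in> A i" "(x, y) \<in> P" for i x y
    using A(1)[of i] that unfolding antichains_def by auto
  have antiB: "x = y" if "i \<in> ?I" "x \<in> B i" "y \<in> B i" "(x, y) \<in> Q" for i x y
    using B(1)[of i] that unfolding antichains_def by auto
  define S where "S = (\<Union>i\<in>?I. A i \<times> B i)"
  have "s = t" if st: "s \<in> S" "t \<in> S" and U: "U \<in> unichains P Q" "s \<in> U" "t \<in> U" for s t U
  proof -
    obtain i p q where i: "i \<in> ?I" "p \<in> A i" "q \<in> B i" "s = (p, q)"
      using st(1) unfolding S_def by blast
    obtain j p' q' where j: "j \<in> ?I" "p' \<in> A j" "q' \<in> B j" "t = (p', q')"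
      using st(2) unfolding S_def by blast
    consider C where "C \<in> Chains Q" "q \<in> C" "q' \<in> C" "p = p'"
      | C where "C \<in> Chains P" "p \<in> C" "p' \<in> C" "q = q'"
      using U i(4) j(4) unfolding unichains_def by blast
    then show ?thesis
    proof cases
      case 1
      then have "i = j" using sameA i j by blast
      moreover have "(q, q') \<in> Q \<or> (q', q) \<in> Q" using 1 unfolding Chains_def by blast
      ultimately show ?thesis using antiB i j 1(4) by blast
    next
      case 2
      then have "i = j" using sameB i j by blast
      moreover have "(p, p') \<in> P \<or> (p', p) \<in> P" using 2 unfolding Chains_def by blast
      ultimately show ?thesis using antiA i j 2(4) by blast
    qed
  qed
  moreover have "S \<subseteq> Field P \<times> Field Q" using sub unfolding S_def by blast
  ultimately have "S \<in> semiantichains P Q" unfolding semiantichains_def by blast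
  moreover have "card S = (\<Sum>i\<in>?I. card (A i \<times> B i))"
    unfolding S_def using fin sameA by (intro card_UN_disjoint) blast+
  then have "card S = (\<Sum>i\<in>?I. greene_mu P i * greene_mu Q i)"
    using A(3) B(3) by (simp add: card_cartesian_product)
  ultimately show thesis by (rule that)
qed

text \<open>A unichain holds at most one element of a semiantichain, so choosing for each element a
  covering unichain is injective.\<close>

lemma card_semiantichain_le_card_covering:
  assumes fin: "finite_poset P" "finite_poset Q"
    and S: "S \<in> semiantichains P Q" and \<U>: "\<U> \<in> unichain_coverings P Q"
  shows "card S \<le> card \<U>"
proof -
  have sub: "\<U> \<subseteq> unichains P Q" and "S \<subseteq> \<Union>\<U>"
    using S \<U> unfolding semiantichains_def unichain_coverings_def by auto
  then have "\<forall>s\<in>S. \<exists>U. U \<in> \<U> \<and> s \<in> U" by blast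
  then obtain f where f: "\<And>s. s \<in> S \<Longrightarrow> f s \<in> \<U> \<and> s \<in> f s" by metis
  have "inj_on f S"
  proof (rule inj_onI)
    fix s t assume st: "s \<in> S" "t \<in> S" "f s = f t"
    then have "f s \<in> unichains P Q" "s \<in> f s" "t \<in> f s"
      using f[OF st(1)] f[OF st(2)] sub by auto
    then show "s = t" using S st unfolding semiantichains_def by blast
  qed
  moreover have "f ` S \<subseteq> \<U>" using f by blast
  moreover have "finite \<U>" using finite_unichains[OF fin] sub finite_subset by blast
  ultimately show ?thesis using card_inj_on_le by blast
qed

theorem theorem8:
  fixes P :: "'a rel" and Q :: "'b rel"
  assumes "finite_poset P" and "finite_poset Q"
    and "d_decomposable P" and "c_decomposable P"
    and "d_decomposable Q"
  shows "Max (card ` semiantichains P Q) = Min (card ` unichain_coverings P Q)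
      \<and> Max (card ` semiantichains P Q) =
           (\<Sum>i = 1..min (height P) (height Q). greene_mu P i * greene_mu Q i)
      \<and> (\<Sum>i = 1..min (height P) (height Q). greene_mu P i * greene_mu Q i) =
           (\<Sum>j = 1..width P. max_k_antichain Q (greene_lambda P j))"
proof -
  let ?n = "\<Sum>i = 1..min (height P) (height Q). greene_mu P i * greene_mu Q i"
  have eq: "(\<Sum>j = 1..width P. max_k_antichain Q (greene_lambda P j)) = ?n"
    using assms by (intro sum_max_k_antichain_lambda)
  obtain S where S: "S \<in> semiantichains P Q" "card S = ?n"
    using semiantichain_exists assms by metis
  obtain \<U> where \<U>: "\<U> \<in> unichain_coverings P Q" "card \<U> \<le> ?n"
    using unichain_covering_exists[OF assms(1,4,2)] eq by metis
  note weak = card_semiantichain_le_card_covering[OF assms(1,2)]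
  \<comment> \<open>\<open>S\<close> and \<open>\<U>\<close> have the same size, so weak duality
    makes each of them optimal. Finiteness of both families then identifies these sizes with
    \<open>Max\<close> and \<open>Min\<close>.\<close>
  have card_\<U>: "card \<U> = ?n" using weak[OF S(1) \<U>(1)] S(2) \<U>(2) by linarith
  have "semiantichains P Q \<subseteq> Pow (Field P \<times> Field Q)"
    unfolding semiantichains_def by blast
  then have "finite (semiantichains P Q)"
    using assms(1,2) unfolding finite_poset_def by (auto intro: finite_subset)
  then have "Max (card ` semiantichains P Q) = card S"
    using S(1) weak[OF _ \<U>(1)] unfolding card_\<U> S(2)[symmetric] by (intro Max_eqI) auto
  moreover have "unichain_coverings P Q \<subseteq> Pow (unichains P Q)"
    unfolding unichain_coverings_def by blast
  then have "finite (unichain_coverings P Q)"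
    using finite_unichains[OF assms(1,2)] by (auto intro: finite_subset)
  then have "Min (card ` unichain_coverings P Q) = card \<U>"
    using \<U>(1) weak[OF S(1)] unfolding S(2) card_\<U>[symmetric] by (intro Min_eqI) auto
  ultimately show ?thesis using S(2) card_\<U> eq by simp
qed

end
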